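(* Let $A\in\mathbb{R}^{n\times n}$, $B\in\mathbb{R}^{n\times p}$ and shifts $\tau_1,\ldots,\tau_\nu\in\mathbb{C}$ be such that $A$ and all $A-\tau_iI$ are nonsingular, let $\mathcal{V}_m$, $V_{m+1}$, $\mathcal{H}_m$, $H_{m+1,m}$ come from the block Arnoldi relation for $A^{-1}$, and let $$\widehat{R}_i^{FOM}=\tau_iV_{m+1}H_{m+1,m}\big(E_m^{\mathrm T}\widehat{Z}_i^{FOM}\big),\quad i=1,2,\ldots,\nu,$$ be the residuals of the preconditioned and shifted block FOM algorithm, where $I-\tau_i\mathcal{H}_m$ is nonsingular and $\widehat{Z}_i^{FOM}=(I-\tau_i\mathcal{H}_m)^{-1}E_1\widehat{R}_i$ (see the context). Let $(\mu_j,\mathcal{V}_m\mathbf{y}_j)$ be the Ritz pairs of $A^{-1}$ and let $\mathbf{r}_j=A^{-1}\mathcal{V}_m\mathbf{y}_j-\mu_j\mathcal{V}_m\mathbf{y}_j$, $j=1,2,\ldots,mp$, be their residuals. If $\mathcal{H}_m=P\Lambda P^{-1}$ is a spectral decomposition of $\mathcal{H}_m$, where $P=[\mathbf{y}_1,\mathbf{y}_2,\ldots,\mathbf{y}_{mp}]$ and $\Lambda=\mathrm{diag}(\mu_1,\mu_2,\ldots,\mu_{mp})$ is diagonal, then $$\widehat{R}_i^{FOM}=\tau_i\big[\mathbf{r}_1,\mathbf{r}_2,\ldots,\mathbf{r}_{mp}\big]\big(P(I-\tau_i\Lambda)\big)^{-1}\big(E_1\widehat{R}_i\big),\quad i=1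,2,\ldots,\nu.$$
   Context: $E_j$ ($1\le j\le m$) is the $mp\times p$ matrix consisting of columns $(j-1)p+1,\ldots,jp$ of the $mp\times mp$ identity matrix; $I$ is an identity matrix of the appropriate size. Block Arnoldi relation (exact arithmetic): $V_1\in\mathbb{R}^{n\times p}$ has orthonormal columns; $\mathcal{V}_{m+1}=[V_1,\ldots,V_{m+1}]=[\mathcal{V}_m,V_{m+1}]$ has orthonormal columns forming a basis of $\mathrm{span}\{V_1,A^{-1}V_1,\ldots,A^{-m}V_1\}$; and $$A^{-1}\mathcal{V}_m=\mathcal{V}_m\mathcal{H}_m+V_{m+1}H_{m+1,m}E_m^{\mathrm T},$$ with $\mathcal{H}_m\in\mathbb{R}^{mp\times mp}$ and $H_{m+1,m}\in\mathbb{R}^{p\times p}$. Preconditioned and shifted block FOM: the systems are $(I-\tau_iA^{-1})Y_i=B$, $i=1,\ldots,\nu$. Given initial guesses $\widehat{Y}_i^0$ with residuals $\widehat{R}_i^0=B-(I-\tau_iA^{-1})\widehat{Y}_i^0=V_1\widehat{R}_i$, where $\widehat{R}_i\in\mathbb{C}^{p\times p}$ and $V_1$ is the same for all $i$, the approximations are $\widehat{Y}_i^{FOM}=\widehat{Y}_i^0+\mathcal{V}_m\widehat{Z}_i^{FOM}$ with $(I-\tau_i\mathcal{H}_m)\widehat{Z}_i^{FOM}=E_1\widehat{R}_i$, and the residuals are $\widehat{R}_i^{FOM}=B-(I-\tau_iA^{-1})\widehat{Y}_i^{FOM}=\tau_iV_{m+1}H_{m+1,m}E_m^{\mathrm T}\widehat{Z}_i^{FOM}$.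 Ritz pairs of $A^{-1}$ with respect to $\mathcal{V}_m$: the pairs $(\mu_j,\mathcal{V}_m\mathbf{y}_j)$ where $\mathcal{H}_m\mathbf{y}_j=\mu_j\mathbf{y}_j$, $\mathbf{y}_j\neq 0$. *)

theory Defs
  imports
    Complex_Main
    "Jordan_Normal_Form.VS_Connect"
    "Jordan_Normal_Form.Char_Poly"
begin

text \<open>Real data enter complex formulas through entrywise embedding.\<close>

abbreviation cmat :: "real mat \<Rightarrow> complex mat" where
  "cmat M \<equiv> map_mat complex_of_real M"

text \<open>The library function \<open>mat_inverse\<close> returns \<open>None\<close> on singular matrices, so this is
  meaningful only for nonsingular arguments.\<close>

abbreviation mat_inv :: "'a::field mat \<Rightarrow> 'a mat" where
  "mat_inv M \<equiv> the (mat_inverse M)"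

text \<open>The matrix \<open>[M\<^sub>1, M\<^sub>2, \<dots>]\<close> for blocks \<open>M\<^sub>k\<close> with \<open>n\<close> rows.\<close>

definition hcat :: "nat \<Rightarrow> 'a mat list \<Rightarrow> 'a mat" where
  "hcat n Ms = mat_of_cols n (concat (map cols Ms))"

text \<open>\<open>E\<^sub>j\<close>, \<open>1 \<le> j \<le> m\<close>. Library columns are numbered from 0, so the columns
  \<open>(j-1)p+1, \<dots>, jp\<close> of the identity have indices \<open>(j-1)p, \<dots>, jp-1\<close>.\<close>

definition block_unit :: "nat \<Rightarrow> nat \<Rightarrow> nat \<Rightarrow> 'a::{zero,one} mat" where
  "block_unit m p j = mat_of_cols (m * p) (map (col (1\<^sub>m (m * p))) [(j - 1) * p ..< j * p])"

definition orthonormal_cols :: "real mat \<Rightarrow> bool" where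
  "orthonormal_cols W \<longleftrightarrow>
     (\<forall>i < dim_col W. \<forall>j < dim_col W. col W i \<bullet> col W j = (if i = j then 1 else 0))"

text \<open>The columns of \<open>W\<close>, listed without repetition, are a basis of the column span of \<open>K\<close>.\<close>

definition cols_basis_of_col_space :: "nat \<Rightarrow> real mat \<Rightarrow> real mat \<Rightarrow> bool" where
  "cols_basis_of_col_space n W K \<longleftrightarrow>
     distinct (cols W) \<and>
     \<not> module.lin_dep class_ring (module_vec TYPE(real) n) (set (cols W)) \<and>
     vec_space.col_space n W = vec_space.col_space n K"

definition basis_blocks :: "nat \<Rightarrow> (nat \<Rightarrow> real mat) \<Rightarrow> nat \<Rightarrow> real mat" where
  "basis_blocks n V k = hcat n (map V [1 ..< k + 1])"

definition block_krylov :: "nat \<Rightarrow> real mat \<Rightarrow> real mat \<Rightarrow> nat \<Rightarrow> real mat" where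
  "block_krylov n M V1 m = hcat n (map (\<lambda>k. M ^\<^sub>m k * V1) [0 ..< m + 1])"

text \<open>\<open>m\<close> steps of the block Arnoldi process for a matrix \<open>M\<close> of order \<open>n\<close> with block size \<open>p\<close>:
  basis blocks \<open>V 1, \<dots>, V (m + 1)\<close>, projected matrix \<open>Hm\<close> and subdiagonal block
  \<open>Hs\<close> (that is, \<open>H\<^sub>m\<^sub>+\<^sub>1\<^sub>,\<^sub>m\<close>).\<close>

definition block_arnoldi ::
  "nat \<Rightarrow> nat \<Rightarrow> nat \<Rightarrow> real mat \<Rightarrow> (nat \<Rightarrow> real mat) \<Rightarrow> real mat \<Rightarrow> real mat \<Rightarrow> bool" where
  "block_arnoldi n p m M V Hm Hs \<longleftrightarrow>
     (\<forall>k \<in> {1..m + 1}. V k \<in> carrier_mat n p) \<and>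
     Hm \<in> carrier_mat (m * p) (m * p) \<and> Hs \<in> carrier_mat p p \<and>
     orthonormal_cols (V 1) \<and>
     orthonormal_cols (basis_blocks n V (m + 1)) \<and>
     cols_basis_of_col_space n (basis_blocks n V (m + 1)) (block_krylov n M (V 1) m) \<and>
     M * basis_blocks n V m =
       basis_blocks n V m * Hm + V (m + 1) * Hs * transpose_mat (block_unit m p m)"

text \<open>Residual \<open>B - (I - \<tau> M) Y\<close> of an approximate solution \<open>Y\<close> of the shifted system
  with (preconditioned) coefficient matrix \<open>I - \<tau> M\<close>.\<close>

definition shifted_residual ::
  "nat \<Rightarrow> real mat \<Rightarrow> real mat \<Rightarrow> complex \<Rightarrow> complex mat \<Rightarrow> complex mat" where
  "shifted_residual n M B t Y = cmat B - (1\<^sub>m n - t \<cdot>\<^sub>m cmat M) * Y"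

definition fom_coeff ::
  "nat \<Rightarrow> nat \<Rightarrow> real mat \<Rightarrow> complex \<Rightarrow> complex mat \<Rightarrow> complex mat" where
  "fom_coeff m p Hm t R = mat_inv (1\<^sub>m (m * p) - t \<cdot>\<^sub>m cmat Hm) * (block_unit m p 1 * R)"

definition fom_approx ::
  "nat \<Rightarrow> nat \<Rightarrow> nat \<Rightarrow> (nat \<Rightarrow> real mat) \<Rightarrow> real mat \<Rightarrow> complex \<Rightarrow> complex mat
   \<Rightarrow> complex mat \<Rightarrow> complex mat" where
  "fom_approx n p m V Hm t Y0 R = Y0 + cmat (basis_blocks n V m) * fom_coeff m p Hm t R"

text \<open>\<open>(\<mu>, W y)\<close> is a Ritz pair with respect to the basis matrix \<open>W\<close> and projected matrix \<open>Hm\<close>;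
  the primitive vector \<open>y\<close> is recorded, and the pair itself is \<open>(\<mu>, ritz_vector W y)\<close>.\<close>

definition ritz_vector :: "real mat \<Rightarrow> complex vec \<Rightarrow> complex vec" where
  "ritz_vector W y = cmat W *\<^sub>v y"

definition ritz_pair :: "real mat \<Rightarrow> real mat \<Rightarrow> complex \<Rightarrow> complex vec \<Rightarrow> complex vec \<Rightarrow> bool" where
  "ritz_pair W Hm \<mu> y x \<longleftrightarrow> eigenvector (cmat Hm) y \<mu> \<and> x = ritz_vector W y"

definition ritz_residual :: "real mat \<Rightarrow> complex \<Rightarrow> complex vec \<Rightarrow> complex vec" where
  "ritz_residual M \<mu> x = cmat M *\<^sub>v x - \<mu> \<cdot>\<^sub>v x"

end

theory Submission
  imports Defs
begin

text \<open>Write \<open>W\<close> for the Arnoldi basis matrix, \<open>H\<close> for the projected matrix, \<open>M\<close> for the inverse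
  of \<open>A\<close>, and \<open>C = V\<^sub>m\<^sub>+\<^sub>1 H\<^sub>m\<^sub>+\<^sub>1\<^sub>,\<^sub>m E\<^sub>m\<^sup>T\<close> for the defect in the Arnoldi relation \<open>M W = W H + C\<close>.
  Both kinds of residual are images of projected quantities under the same matrix \<open>C\<close>.

  For the linear systems, \<open>(I - \<tau> M) W = W (I - \<tau> H) - \<tau> C\<close>. The coefficient \<open>Z\<close> is chosen such that
  \<open>W (I - \<tau> H) Z = W E\<^sub>1 R = V\<^sub>1 R\<close>, which is the initial residual; what remains after the update
  is \<open>\<tau> C Z\<close> (\<open>fom_residual\<close>).
  For the eigenvalue problem, \<open>M W y - \<mu> W y = W (H y - \<mu> y) + C y = C y\<close>, so that the matrix of all
  Ritz residuals is \<open>C P\<close> (\<open>ritz_residual_matrix\<close>).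

  Finally \<open>(I - \<tau> H) P = P (I - \<tau> \<Lambda>)\<close>, because \<open>H P = P \<Lambda>\<close>. Hence
  \<open>C P (P (I - \<tau> \<Lambda>))\<^sup>-\<^sup>1 = C (I - \<tau> H)\<^sup>-\<^sup>1\<close>, and applying both sides to \<open>E\<^sub>1 R\<close> gives \<open>C Z\<close> on the
  right (\<open>diagonalized_resolvent\<close>).\<close>

section \<open>Inverses of matrices over a field\<close>

lemma mat_inv_eqI:
  fixes A :: "'a::field mat"
  assumes A: "A \<in> carrier_mat n n" and B: "B \<in> carrier_mat n n" and AB: "A * B = 1\<^sub>m n"
  shows "mat_inv A = B"
proof -
  have BA: "B * A = 1\<^sub>m n"
    using mat_mult_left_right_inverse[OF A B AB] .
  have "A \<in> Units (ring_mat TYPE('a) n ())"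
    using A B AB BA by (auto simp: Units_def ring_mat_def)
  then obtain C where inv: "mat_inverse A = Some C"
    using mat_inverse(1)[OF A, where b = "()"] by (cases "mat_inverse A") auto
  have C: "C \<in> carrier_mat n n" "C * A = 1\<^sub>m n"
    using mat_inverse(2)[OF A inv] by auto
  have "C = C * (A * B)" using AB C by simp
  also have "\<dots> = (C * A) * B" by (rule assoc_mult_mat[symmetric, OF C(1) A B])
  finally show ?thesis using B C inv by simp
qed

lemma mat_inv_invertible:
  fixes A :: "'a::field mat"
  assumes A: "A \<in> carrier_mat n n" and inv: "invertible_mat A"
  shows "mat_inv A \<in> carrier_mat n n" "A * mat_inv A = 1\<^sub>m n" "mat_inv A * A = 1\<^sub>m n"
proof -
  obtain B where B: "A * B = 1\<^sub>m n" "B * A = 1\<^sub>m (dim_row B)"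
    using inv A unfolding invertible_mat_def inverts_mat_def by auto
  have "dim_col B = n" using arg_cong[OF B(1), of dim_col] by simp
  moreover have "dim_row B = n" using arg_cong[OF B(2), of dim_col] A by simp
  ultimately have Bc: "B \<in> carrier_mat n n" by auto
  then have "mat_inv A = B" by (rule mat_inv_eqI[OF A _ B(1)])
  then show "mat_inv A \<in> carrier_mat n n" "A * mat_inv A = 1\<^sub>m n" "mat_inv A * A = 1\<^sub>m n"
    using B Bc by auto
qed

section \<open>Block columns\<close>

lemma block_unit_carrier:
  assumes "1 \<le> j"
  shows "block_unit m p j \<in> carrier_mat (m * p) p"
proof -
  have "j * p - (j - 1) * p = p" using assms by (simp add: diff_mult_distrib)
  then have "length (map (col (1\<^sub>m (m * p))) [(j - 1) * p ..< j * p]) = p" by simp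
  then show ?thesis unfolding block_unit_def by (metis mat_of_cols_carrier(1))
qed

text \<open>The real \<open>E\<^sub>j\<close> of the Arnoldi relation and the complex \<open>E\<^sub>j\<close> of the FOM residual are
  instances of one polymorphic constant; this identifies them under the embedding.\<close>

lemma cmat_block_unit:
  assumes "j \<le> m"
  shows "cmat (block_unit m p j) = block_unit m p j"
proof -
  have bound: "(j - 1) * p + k < m * p" if "k < j * p - (j - 1) * p" for k
  proof -
    have "(j - 1) * p + k < j * p" using that by linarith
    also have "\<dots> \<le> m * p" using assms by simp
    finally show ?thesis .
  qed
  show ?thesis
    unfolding block_unit_def by (rule eq_matI) (auto simp: mat_of_cols_index bound[simplified])
qed

lemma length_concat_cols:
  assumes "\<And>k. k \<in> set ks \<Longrightarrow> V k \<in> carrier_mat n p"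
  shows "length (concat (map cols (map V ks))) = length ks * p"
  using assms by (induction ks) auto

lemma basis_blocks_carrier:
  assumes "\<And>k. k \<in> {1..m} \<Longrightarrow> V k \<in> carrier_mat n p"
  shows "basis_blocks n V m \<in> carrier_mat n (m * p)"
proof -
  have "length (concat (map cols (map V [1 ..< m + 1]))) = m * p"
    using length_concat_cols[of "[1 ..< m + 1]" V n p] assms by (simp del: upt_Suc)
  then show ?thesis
    unfolding basis_blocks_def hcat_def by (metis mat_of_cols_carrier(1))
qed

lemma mult_mat_unit_vec:
  fixes M :: "'a::semiring_1 mat"
  assumes "M \<in> carrier_mat n k" "j < k"
  shows "M *\<^sub>v unit_vec k j = col M j"
  using assms by (intro eq_vecI) auto

text \<open>\<open>E\<^sub>1\<close> selects the first block. This is what links the projected right-hand side \<open>E\<^sub>1 R\<close> to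
  the initial residual \<open>V\<^sub>1 R\<close>.\<close>

lemma basis_blocks_mult_block_unit_1:
  assumes m: "1 \<le> m" and V: "\<And>k. k \<in> {1..m} \<Longrightarrow> V k \<in> carrier_mat n p"
  shows "basis_blocks n V m * block_unit m p 1 = V 1"
proof -
  let ?W = "basis_blocks n V m"
  let ?E = "block_unit m p 1 :: real mat"
  let ?cs = "concat (map cols (map V [1 ..< m + 1]))"
  have V1: "V 1 \<in> carrier_mat n p" using V m by auto
  have W: "?W \<in> carrier_mat n (m * p)" by (rule basis_blocks_carrier[OF V])
  have E: "?E \<in> carrier_mat (m * p) p" by (rule block_unit_carrier) simp
  have pm: "p \<le> m * p" using m by simp
  have len: "length ?cs = m * p"
    using length_concat_cols[of "[1 ..< m + 1]" V n p] V by (simp del: upt_Suc)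
  have split: "?cs = cols (V 1) @ concat (map cols (map V [2 ..< m + 1]))"
    using m by (simp add: upt_conv_Cons numeral_2_eq_2 del: upt_Suc)
  show ?thesis
  proof (rule mat_col_eqI)
    fix j assume "j < dim_col (V 1)"
    then have j: "j < p" using V1 by simp
    have jm: "j < m * p" using j pm by (rule less_le_trans)
    have Ej: "col ?E j = unit_vec (m * p) j"
      unfolding block_unit_def using j jm by simp
    have nth: "?cs ! j = col (V 1) j"
      unfolding split using j V1 by (simp add: nth_append)
    have "col (?W * ?E) j = ?W *\<^sub>v col ?E j" by (rule col_mult2[OF W E j])
    also have "\<dots> = col ?W j" unfolding Ej by (rule mult_mat_unit_vec[OF W jm])
    also have "\<dots> = ?cs ! j"
      unfolding basis_blocks_def hcat_def
    proof (rule col_mat_of_cols)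
      show "j < length ?cs" using len jm by simp
      show "?cs ! j \<in> carrier_vec n"
        unfolding nth using V1 by auto
    qed
    also have "\<dots> = col (V 1) j" by (rule nth)
    finally show "col (?W * ?E) j = col (V 1) j" .
  qed (use W E V1 in auto)
qed

section \<open>Residuals of projected problems\<close>

text \<open>If the columns of \<open>W\<close> span an invariant subspace of \<open>M\<close> up to the defect \<open>C\<close>, then the same
  holds for the shifted matrix, with the defect scaled by \<open>- t\<close>. A correction \<open>W Z\<close> whose
  coefficients solve the projected system therefore cancels \<open>W F\<close> up to the
  image of \<open>Z\<close> under the scaled defect.\<close>

lemma projected_residual:
  fixes M W H C Z :: "'a::comm_ring_1 mat"
  assumes M: "M \<in> carrier_mat n n" and W: "W \<in> carrier_mat n N"
    and H: "H \<in> carrier_mat N N" and C: "C \<in> carrier_mat n N"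
    and Z: "Z \<in> carrier_mat N q" and F: "F \<in> carrier_mat N q"
    and rel: "M * W = W * H + C"
    and proj: "(1\<^sub>m N - t \<cdot>\<^sub>m H) * Z = F"
  shows "W * F - (1\<^sub>m n - t \<cdot>\<^sub>m M) * (W * Z) = t \<cdot>\<^sub>m (C * Z)"
proof -
  have WZ: "W * Z \<in> carrier_mat n q" and HZ: "H * Z \<in> carrier_mat N q"
    and WHZ: "W * (H * Z) \<in> carrier_mat n q" and CZ: "C * Z \<in> carrier_mat n q"
    using assms by auto
  have "F = Z - t \<cdot>\<^sub>m (H * Z)"
    unfolding proj[symmetric] using H Z
    by (simp add: minus_mult_distrib_mat[of _ N N] mult_smult_assoc_mat[of _ N N])
  then have left: "W * F = W * Z - t \<cdot>\<^sub>m (W * (H * Z))"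
    using W Z HZ by (simp add: mult_minus_distrib_mat[of _ n N _ q] mult_smult_distrib[of _ n N])
  have "M * (W * Z) = (W * H + C) * Z"
    unfolding rel[symmetric] using M W Z by simp
  also have "\<dots> = W * (H * Z) + C * Z"
    using W H C Z by (simp add: add_mult_distrib_mat[of _ n N _ _ q])
  finally have "M * (W * Z) = W * (H * Z) + C * Z" .
  then have right: "(1\<^sub>m n - t \<cdot>\<^sub>m M) * (W * Z) = W * Z - t \<cdot>\<^sub>m (W * (H * Z) + C * Z)"
    using M WZ by (simp add: minus_mult_distrib_mat[of _ n n] mult_smult_assoc_mat[of _ n n]
        left_mult_one_mat[of _ n q])
  have "(X - t \<cdot>\<^sub>m Y) - (X - t \<cdot>\<^sub>m (Y + U)) = t \<cdot>\<^sub>m U"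
    if "X \<in> carrier_mat n q" "Y \<in> carrier_mat n q" "U \<in> carrier_mat n q" for X Y U :: "'a mat"
    using that by (intro eq_matI) (auto simp: algebra_simps)
  from this[OF WZ WHZ CZ] show ?thesis unfolding left right .
qed

text \<open>Only the projected residual \<open>H y - \<mu> y\<close> could contribute inside the column space of \<open>W\<close>, and
  it vanishes for an eigenvector.\<close>

lemma ritz_residual_defect:
  fixes M W Hm :: "real mat"
  assumes M: "M \<in> carrier_mat n n" and W: "W \<in> carrier_mat n N"
    and H: "Hm \<in> carrier_mat N N" and C: "C \<in> carrier_mat n N"
    and rel: "cmat M * cmat W = cmat W * cmat Hm + C"
    and ritz: "ritz_pair W Hm \<mu> y x"
  shows "ritz_residual M \<mu> x = C *\<^sub>v y"
proof -
  have y: "y \<in> carrier_vec N" and Hy: "cmat Hm *\<^sub>v y = \<mu> \<cdot>\<^sub>v y" and x: "x = cmat W *\<^sub>v y"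
    using ritz H unfolding ritz_pair_def eigenvector_def ritz_vector_def by auto
  have cM: "cmat M \<in> carrier_mat n n" and cW: "cmat W \<in> carrier_mat n N"
    and cH: "cmat Hm \<in> carrier_mat N N"
    using M W H by auto
  have "cmat M *\<^sub>v x = (cmat W * cmat Hm + C) *\<^sub>v y"
    unfolding x rel[symmetric] using cM cW y by simp
  also have "\<dots> = cmat W *\<^sub>v (cmat Hm *\<^sub>v y) + C *\<^sub>v y"
    using cW cH C y by (simp add: add_mult_distrib_mat_vec[of _ n N])
  also have "\<dots> = \<mu> \<cdot>\<^sub>v x + C *\<^sub>v y"
    unfolding Hy x using cW y by (simp add: mult_mat_vec[of _ n N])
  finally show ?thesis
    unfolding ritz_residual_def using cW C y x by (intro eq_vecI) auto
qed

lemma ritz_residual_matrix: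
  fixes M W Hm :: "real mat"
  assumes M: "M \<in> carrier_mat n n" and W: "W \<in> carrier_mat n N"
    and H: "Hm \<in> carrier_mat N N" and C: "C \<in> carrier_mat n N"
    and rel: "cmat M * cmat W = cmat W * cmat Hm + C"
    and ritz: "\<And>j. j \<in> {1..N} \<Longrightarrow> ritz_pair W Hm (\<mu> j) (y j) (x j)"
  shows "mat_of_cols n (map (\<lambda>j. ritz_residual M (\<mu> j) (x j)) [1 ..< N + 1])
    = C * mat_of_cols N (map y [1 ..< N + 1])"
    (is "?R = C * ?P")
proof (rule mat_col_eqI)
  have P: "?P \<in> carrier_mat N N"
    using mat_of_cols_carrier(1)[of N "map y [1 ..< N + 1]"] by (simp del: upt_Suc)
  fix j assume "j < dim_col (C * ?P)"
  then have j: "j < N" by (simp del: upt_Suc)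
  have y: "y (Suc j) \<in> carrier_vec N"
    using ritz[of "Suc j"] j H unfolding ritz_pair_def eigenvector_def by auto
  have res: "ritz_residual M (\<mu> (Suc j)) (x (Suc j)) = C *\<^sub>v y (Suc j)"
    by (rule ritz_residual_defect[OF M W H C rel ritz]) (use j in auto)
  have "col ?R j = map (\<lambda>j. ritz_residual M (\<mu> j) (x j)) [1 ..< N + 1] ! j"
    by (rule col_mat_of_cols) (use j C res y in \<open>auto simp del: upt_Suc\<close>)
  also have "\<dots> = C *\<^sub>v y (Suc j)" using j res by (simp del: upt_Suc)
  also have "\<dots> = C *\<^sub>v col ?P j"
    using j y by (subst col_mat_of_cols) (auto simp del: upt_Suc)
  also have "\<dots> = col (C * ?P) j" by (rule col_mult2[OF C P j, symmetric])
  finally show "col ?R j = col (C * ?P) j" .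
qed (use C in \<open>simp_all del: upt_Suc\<close>)

text \<open>A similarity \<open>H = P L P\<^sup>-\<^sup>1\<close> passes to the shifted matrices, so \<open>P (I - t L)\<close> is the
  product \<open>(I - t H) P\<close> of two invertible factors; on inversion the factor \<open>P\<close> cancels.\<close>

lemma diagonalized_resolvent:
  fixes H P L :: "'a::field mat"
  assumes H: "H \<in> carrier_mat N N" and P: "P \<in> carrier_mat N N" and L: "L \<in> carrier_mat N N"
    and invP: "invertible_mat P" and invS: "invertible_mat (1\<^sub>m N - t \<cdot>\<^sub>m H)"
    and HP: "H = P * L * mat_inv P"
  shows "mat_inv (P * (1\<^sub>m N - t \<cdot>\<^sub>m L)) \<in> carrier_mat N N"
    and "P * mat_inv (P * (1\<^sub>m N - t \<cdot>\<^sub>m L)) = mat_inv (1\<^sub>m N - t \<cdot>\<^sub>m H)"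
proof -
  let ?S = "1\<^sub>m N - t \<cdot>\<^sub>m H"
  let ?P' = "mat_inv P"
  let ?S' = "mat_inv ?S"
  have S: "?S \<in> carrier_mat N N" using H by (intro minus_carrier_mat smult_carrier_mat)
  note P' = mat_inv_invertible[OF P invP]
  note S' = mat_inv_invertible[OF S invS]
  have "H * P = (P * L) * (?P' * P)"
    unfolding HP by (rule assoc_mult_mat) (use P L P' in auto)
  then have comm: "H * P = P * L" using P L P'(3) by simp
  have "P * (1\<^sub>m N - t \<cdot>\<^sub>m L) = P - t \<cdot>\<^sub>m (P * L)"
    using P L by (simp add: mult_minus_distrib_mat[of _ N N _ N] mult_smult_distrib[of _ N N])
  also have "\<dots> = ?S * P"
    unfolding comm[symmetric] using P H
    by (simp add: minus_mult_distrib_mat[of _ N N] mult_smult_assoc_mat[of _ N N])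
  finally have Q: "P * (1\<^sub>m N - t \<cdot>\<^sub>m L) = ?S * P" .
  have "(?S * P) * (?P' * ?S') = ?S * ((P * ?P') * ?S')"
    using S P P'(1) S'(1) by (simp add: assoc_mult_mat[of _ N N _ N _ N])
  also have "\<dots> = 1\<^sub>m N" using P'(2) S'(1,2) by simp
  finally have inv: "mat_inv (P * (1\<^sub>m N - t \<cdot>\<^sub>m L)) = ?P' * ?S'"
    unfolding Q using S P P'(1) S'(1) by (intro mat_inv_eqI[of _ N]) auto
  show "mat_inv (P * (1\<^sub>m N - t \<cdot>\<^sub>m L)) \<in> carrier_mat N N"
    unfolding inv using P'(1) S'(1) by simp
  have "P * mat_inv (P * (1\<^sub>m N - t \<cdot>\<^sub>m L)) = P * (?P' * ?S')" unfolding inv ..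
  also have "\<dots> = (P * ?P') * ?S'"
    using P P'(1) S'(1) by (simp add: assoc_mult_mat[of _ N N _ N _ N])
  finally show "P * mat_inv (P * (1\<^sub>m N - t \<cdot>\<^sub>m L)) = ?S'" using P'(2) S'(1) by simp
qed

section \<open>Block Arnoldi and FOM\<close>

lemma block_arnoldi_complex_relation:
  assumes "1 \<le> m" and M: "M \<in> carrier_mat n n" and arnoldi: "block_arnoldi n p m M V Hm Hs"
  shows "cmat M * cmat (basis_blocks n V m) = cmat (basis_blocks n V m) * cmat Hm
    + cmat (V (m + 1)) * cmat Hs * transpose_mat (block_unit m p m)"
proof -
  let ?W = "basis_blocks n V m"
  let ?E = "block_unit m p m :: real mat"
  have V: "V k \<in> carrier_mat n p" if "k \<in> {1..m + 1}" for k
    using arnoldi that unfolding block_arnoldi_def by blast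
  have Hm: "Hm \<in> carrier_mat (m * p) (m * p)" and Hs: "Hs \<in> carrier_mat p p"
    and rel: "M * ?W = ?W * Hm + V (m + 1) * Hs * transpose_mat ?E"
    using arnoldi unfolding block_arnoldi_def by auto
  have W: "?W \<in> carrier_mat n (m * p)" by (rule basis_blocks_carrier) (use V in auto)
  have E: "transpose_mat ?E \<in> carrier_mat p (m * p)"
    using block_unit_carrier[OF \<open>1 \<le> m\<close>] by simp
  have Vn: "V (m + 1) \<in> carrier_mat n p" using V by simp
  have VHs: "V (m + 1) * Hs \<in> carrier_mat n p" using Vn Hs by simp
  have "cmat M * cmat ?W = cmat (?W * Hm + V (m + 1) * Hs * transpose_mat ?E)"
    unfolding rel[symmetric] by (rule of_real_hom.mat_hom_mult[OF M W, symmetric])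
  also have "\<dots> = cmat (?W * Hm) + cmat (V (m + 1) * Hs * transpose_mat ?E)"
    using W Hm VHs E by (intro eq_matI) auto
  also have "cmat (?W * Hm) = cmat ?W * cmat Hm"
    by (rule of_real_hom.mat_hom_mult[OF W Hm])
  also have "cmat (V (m + 1) * Hs * transpose_mat ?E)
      = cmat (V (m + 1)) * cmat Hs * cmat (transpose_mat ?E)"
    by (simp only: of_real_hom.mat_hom_mult[OF VHs E] of_real_hom.mat_hom_mult[OF Vn Hs])
  also have "cmat (transpose_mat ?E) = transpose_mat (block_unit m p m)"
    using cmat_block_unit[of m m p] by (simp add: map_mat_transpose[symmetric])
  finally show ?thesis .
qed

text \<open>The initial residual lies in the range of the Arnoldi basis, as \<open>W (E\<^sub>1 R)\<close>. The update
  cancels it, and what is left is the defect of the Arnoldi relation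
  (\<open>projected_residual\<close> with \<open>F = E\<^sub>1 R\<close>).\<close>

lemma fom_residual:
  fixes M B :: "real mat" and R :: "complex mat"
  assumes m: "1 \<le> m" and M: "M \<in> carrier_mat n n" and B: "B \<in> carrier_mat n p"
    and arnoldi: "block_arnoldi n p m M V Hm Hs"
    and Y0: "Y0 \<in> carrier_mat n p" and R: "R \<in> carrier_mat p p"
    and init: "shifted_residual n M B t Y0 = cmat (V 1) * R"
    and inv: "invertible_mat (1\<^sub>m (m * p) - t \<cdot>\<^sub>m cmat Hm)"
  shows "shifted_residual n M B t (fom_approx n p m V Hm t Y0 R)
    = t \<cdot>\<^sub>m (cmat (V (m + 1)) * cmat Hs * transpose_mat (block_unit m p m)
        * fom_coeff m p Hm t R)"
proof -
  let ?W = "basis_blocks n V m"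
  let ?E = "block_unit m p 1 :: complex mat"
  let ?C = "cmat (V (m + 1)) * cmat Hs * transpose_mat (block_unit m p m)"
  let ?Z = "fom_coeff m p Hm t R"
  let ?S = "1\<^sub>m (m * p) - t \<cdot>\<^sub>m cmat Hm"
  let ?G = "1\<^sub>m n - t \<cdot>\<^sub>m cmat M"
  have V: "V k \<in> carrier_mat n p" if "k \<in> {1..m + 1}" for k
    using arnoldi that unfolding block_arnoldi_def by blast
  have Hm: "cmat Hm \<in> carrier_mat (m * p) (m * p)" and Hs: "cmat Hs \<in> carrier_mat p p"
    using arnoldi unfolding block_arnoldi_def by auto
  have Wr: "?W \<in> carrier_mat n (m * p)" by (rule basis_blocks_carrier) (use V in auto)
  then have W: "cmat ?W \<in> carrier_mat n (m * p)" by simp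
  have cM: "cmat M \<in> carrier_mat n n" using M by simp
  have C: "?C \<in> carrier_mat n (m * p)"
    using V[of "m + 1"] Hs block_unit_carrier[OF m] by (intro mult_carrier_mat[of _ n p]) auto
  have E: "?E \<in> carrier_mat (m * p) p" by (rule block_unit_carrier) simp
  have ER: "?E * R \<in> carrier_mat (m * p) p" using E R by simp
  have S: "?S \<in> carrier_mat (m * p) (m * p)" using Hm by (intro minus_carrier_mat smult_carrier_mat) simp
  note S' = mat_inv_invertible[OF S inv]
  have Z: "?Z \<in> carrier_mat (m * p) p" unfolding fom_coeff_def using S'(1) ER by simp
  have "?S * ?Z = ?S * mat_inv ?S * (?E * R)"
    unfolding fom_coeff_def by (rule assoc_mult_mat[symmetric, OF S S'(1) ER])
  then have proj: "?S * ?Z = ?E * R" unfolding S'(2) left_mult_one_mat[OF ER] .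
  have "?W * block_unit m p 1 = V 1"
    by (rule basis_blocks_mult_block_unit_1[OF m]) (use V in auto)
  then have "cmat (V 1) = cmat (?W * block_unit m p 1)" by (simp only:)
  also have "\<dots> = cmat ?W * cmat (block_unit m p 1)"
    by (rule of_real_hom.mat_hom_mult[OF Wr block_unit_carrier]) simp
  also have "cmat (block_unit m p 1) = ?E" by (rule cmat_block_unit[OF m])
  finally have "cmat (V 1) * R = cmat ?W * ?E * R" by (rule arg_cong)
  also have "\<dots> = cmat ?W * (?E * R)" by (rule assoc_mult_mat[OF W E R])
  finally have init': "cmat B - ?G * Y0 = cmat ?W * (?E * R)"
    using init unfolding shifted_residual_def by simp
  have G: "?G \<in> carrier_mat n n" using cM by (intro minus_carrier_mat smult_carrier_mat)
  have WZ: "cmat ?W * ?Z \<in> carrier_mat n p" using W Z by simp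
  have dist: "?G * (Y0 + cmat ?W * ?Z) = ?G * Y0 + ?G * (cmat ?W * ?Z)"
    by (rule mult_add_distrib_mat[OF G Y0 WZ])
  have GY: "?G * Y0 \<in> carrier_mat n p" and GWZ: "?G * (cmat ?W * ?Z) \<in> carrier_mat n p"
    by (rule mult_carrier_mat[OF G Y0], rule mult_carrier_mat[OF G WZ])
  have "cmat B - (?G * Y0 + ?G * (cmat ?W * ?Z)) = (cmat B - ?G * Y0) - ?G * (cmat ?W * ?Z)"
  proof -
    have "X - (Y + U) = (X - Y) - U"
      if "X \<in> carrier_mat n p" "Y \<in> carrier_mat n p" "U \<in> carrier_mat n p"
      for X Y U :: "complex mat"
      using that by (intro eq_matI) auto
    then show ?thesis using B GY GWZ by simp
  qed
  also have "\<dots> = t \<cdot>\<^sub>m (?C * ?Z)"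
    unfolding init'
    by (rule projected_residual[OF cM W Hm C Z ER block_arnoldi_complex_relation[OF m M arnoldi] proj])
  finally show ?thesis unfolding shifted_residual_def fom_approx_def dist .
qed

theorem theorem4p2:
  fixes n p m \<nu> :: nat
    and A B :: "real mat"
    and \<tau> :: "nat \<Rightarrow> complex"
    and V :: "nat \<Rightarrow> real mat" and Hm Hs :: "real mat"
    and Y0 Rhat Z R_FOM :: "nat \<Rightarrow> complex mat"
    and \<mu> :: "nat \<Rightarrow> complex" and y x r :: "nat \<Rightarrow> complex vec"
    and P \<Lambda> :: "complex mat"
  assumes "m \<ge> 1" "p \<ge> 1"
    and "A \<in> carrier_mat n n" "B \<in> carrier_mat n p"
    and "invertible_mat A"
    and "\<And>i. i \<in> {1..\<nu>} \<Longrightarrow> invertible_mat (cmat A - \<tau> i \<cdot>\<^sub>m 1\<^sub>m n)"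
    and "block_arnoldi n p m (mat_inv A) V Hm Hs"
    and "\<And>i. i \<in> {1..\<nu>} \<Longrightarrow> Y0 i \<in> carrier_mat n p"
    and "\<And>i. i \<in> {1..\<nu>} \<Longrightarrow> Rhat i \<in> carrier_mat p p"
    and "\<And>i. i \<in> {1..\<nu>} \<Longrightarrow>
           shifted_residual n (mat_inv A) B (\<tau> i) (Y0 i) = cmat (V 1) * Rhat i"
    and "\<And>i. i \<in> {1..\<nu>} \<Longrightarrow> invertible_mat (1\<^sub>m (m * p) - \<tau> i \<cdot>\<^sub>m cmat Hm)"
    and "\<And>i. i \<in> {1..\<nu>} \<Longrightarrow> Z i = fom_coeff m p Hm (\<tau> i) (Rhat i)"
    and "\<And>i. i \<in> {1..\<nu>} \<Longrightarrow>
           R_FOM i = shifted_residual n (mat_inv A) B (\<tau> i)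
                       (fom_approx n p m V Hm (\<tau> i) (Y0 i) (Rhat i))"
    and "\<And>j. j \<in> {1..m * p} \<Longrightarrow> ritz_pair (basis_blocks n V m) Hm (\<mu> j) (y j) (x j)"
    and "\<And>j. j \<in> {1..m * p} \<Longrightarrow> r j = ritz_residual (mat_inv A) (\<mu> j) (x j)"
    and "P = mat_of_cols (m * p) (map y [1 ..< m * p + 1])"
    and "\<Lambda> = mat_diag (m * p) (\<lambda>k. \<mu> (k + 1))"
    and "invertible_mat P" "cmat Hm = P * \<Lambda> * mat_inv P"
  shows "\<forall>i \<in> {1..\<nu>}.
           R_FOM i = \<tau> i \<cdot>\<^sub>m (cmat (V (m + 1)) * cmat Hs
                       * (transpose_mat (block_unit m p m) * Z i)) \<and>
           R_FOM i = \<tau> i \<cdot>\<^sub>m (mat_of_cols n (map r [1 ..< m * p + 1])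
                       * mat_inv (P * (1\<^sub>m (m * p) - \<tau> i \<cdot>\<^sub>m \<Lambda>))
                       * (block_unit m p 1 * Rhat i))"
proof
  fix i assume i: "i \<in> {1..\<nu>}"
  note m = assms(1) and arnoldi = assms(7)
  define M where "M = mat_inv A"
  define C where "C = cmat (V (m + 1)) * cmat Hs * transpose_mat (block_unit m p m)"
  let ?N = "m * p"
  let ?W = "basis_blocks n V m"
  let ?Q = "P * (1\<^sub>m ?N - \<tau> i \<cdot>\<^sub>m \<Lambda>)"
  let ?F = "block_unit m p 1 * Rhat i"
  have M: "M \<in> carrier_mat n n"
    unfolding M_def by (rule mat_inv_invertible(1)[OF assms(3,5)])
  note arnoldi' = arnoldi[folded M_def]
  have V: "V k \<in> carrier_mat n p" if "k \<in> {1..m + 1}" for k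
    using arnoldi that unfolding block_arnoldi_def by blast
  have Hm: "Hm \<in> carrier_mat ?N ?N" and Hs: "Hs \<in> carrier_mat p p"
    using arnoldi unfolding block_arnoldi_def by auto
  have VHs: "cmat (V (m + 1)) * cmat Hs \<in> carrier_mat n p"
    using V[of "m + 1"] Hs by (intro mult_carrier_mat[of _ n p]) auto
  have Et: "transpose_mat (block_unit m p m) \<in> carrier_mat p ?N"
    using block_unit_carrier[OF m] by simp
  have C: "C \<in> carrier_mat n ?N" unfolding C_def by (rule mult_carrier_mat[OF VHs Et])
  have W: "?W \<in> carrier_mat n ?N" by (rule basis_blocks_carrier) (use V in auto)
  have P: "P \<in> carrier_mat ?N ?N" unfolding assms(16)
    using mat_of_cols_carrier(1)[of ?N "map y [1 ..< ?N + 1]"] by (simp del: upt_Suc)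
  have L: "\<Lambda> \<in> carrier_mat ?N ?N" unfolding assms(17) by simp
  have F: "?F \<in> carrier_mat ?N p"
    by (rule mult_carrier_mat[OF block_unit_carrier assms(9)[OF i]]) simp
  have S: "1\<^sub>m ?N - \<tau> i \<cdot>\<^sub>m cmat Hm \<in> carrier_mat ?N ?N"
    using Hm by (intro minus_carrier_mat smult_carrier_mat) simp
  note S' = mat_inv_invertible(1)[OF S assms(11)[OF i]]
  have Z: "Z i = mat_inv (1\<^sub>m ?N - \<tau> i \<cdot>\<^sub>m cmat Hm) * ?F"
    unfolding assms(12)[OF i] fom_coeff_def ..
  have Zc: "Z i \<in> carrier_mat ?N p" unfolding Z by (rule mult_carrier_mat[OF S' F])

  have res: "R_FOM i = \<tau> i \<cdot>\<^sub>m (C * Z i)"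
    unfolding assms(13)[OF i] assms(12)[OF i] C_def M_def[symmetric]
    by (rule fom_residual[OF m M assms(4) arnoldi' assms(8)[OF i] assms(9)[OF i]
          assms(10)[OF i, folded M_def] assms(11)[OF i]])

  have "mat_of_cols n (map r [1 ..< ?N + 1])
      = mat_of_cols n (map (\<lambda>j. ritz_residual M (\<mu> j) (x j)) [1 ..< ?N + 1])"
    using assms(15) unfolding M_def
    by (intro arg_cong[where f = "mat_of_cols n"] map_cong) auto
  also have "\<dots> = C * P"
    unfolding assms(16)
    by (rule ritz_residual_matrix[OF M W Hm C _ assms(14)])
      (use block_arnoldi_complex_relation[OF m M arnoldi'] in \<open>auto simp: C_def\<close>)
  finally have ritz: "mat_of_cols n (map r [1 ..< ?N + 1]) = C * P" .

  have "cmat Hm \<in> carrier_mat ?N ?N" using Hm by simp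
  note diag = diagonalized_resolvent[OF this P L assms(18) assms(11)[OF i] assms(19)]
  have "C * P * mat_inv ?Q * ?F = C * (P * mat_inv ?Q) * ?F"
    by (simp only: assoc_mult_mat[OF C P diag(1)])
  also have "\<dots> = C * Z i"
    unfolding diag(2) Z by (rule assoc_mult_mat[OF C S' F])
  finally have "R_FOM i = \<tau> i \<cdot>\<^sub>m (mat_of_cols n (map r [1 ..< ?N + 1]) * mat_inv ?Q * ?F)"
    unfolding res ritz by simp
  moreover have "C * Z i
      = cmat (V (m + 1)) * cmat Hs * (transpose_mat (block_unit m p m) * Z i)"
    unfolding C_def by (rule assoc_mult_mat[OF VHs Et Zc])
  ultimately show "R_FOM i = \<tau> i \<cdot>\<^sub>m (cmat (V (m + 1)) * cmat Hs
        * (transpose_mat (block_unit m p m) * Z i)) \<and>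
      R_FOM i = \<tau> i \<cdot>\<^sub>m (mat_of_cols n (map r [1 ..< ?N + 1]) * mat_inv ?Q * ?F)"
    using res by simp
qed

end
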